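(* Let $S\subseteq\mathbb{F}_2^n$ be a powerful set and let $\mathbf{v}\in S$ be a nonzero vector. Define $S+\Box\setminus\mathbf{v}\subseteq\mathbb{F}_2^{n+1}$ by \[S+\Box\setminus\mathbf{v}:=\{\mathbf{0}0,\ \mathbf{v}0\}\cup\{\mathbf{u}1\mid \mathbf{u}\in S\setminus\{\mathbf{0},\mathbf{v}\}\},\] where $\mathbf{u}a$ denotes the vector of length $n+1$ obtained by appending the bit $a$ to $\mathbf{u}$. Then $S+\Box\setminus\mathbf{v}$ is a powerful set.
   Context: A set $S\subseteq\mathbb{F}_2^n$ (positions indexed by $[n]=\{1,\dots,n\}$) is called a powerful set if for every $X\subseteq[n]$ the number of vectors in $S$ whose coordinates in all positions of $X$ are zero is a power of $2$. *)

theory Defs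
  imports "Jordan_Normal_Form.Matrix" "HOL-Library.Z2"
begin

text \<open>
  The space $F_2^n$ is \<^term>\<open>carrier_vec n :: bit vec set\<close>. Vector entries are numbered from 0,
  so position $i$ of $\{1,\dots,n\}$ is the index $i - 1$ and $\{1,\dots,n\}$ becomes
  \<^term>\<open>{..<n}\<close>.
\<close>

definition powerful_set :: "nat \<Rightarrow> bit vec set \<Rightarrow> bool" where
  "powerful_set n S \<longleftrightarrow>
     S \<subseteq> carrier_vec n \<and>
     (\<forall>X \<subseteq> {..<n}. \<exists>k. card {u \<in> S. \<forall>i\<in>X. u $ i = 0} = 2 ^ k)"

definition append_bit :: "bit vec \<Rightarrow> bit \<Rightarrow> bit vec" where
  "append_bit u a = u @\<^sub>v vec_of_list [a]"

text \<open>The set $S + \Box \setminus v$.\<close>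

definition add_box_minus :: "nat \<Rightarrow> bit vec set \<Rightarrow> bit vec \<Rightarrow> bit vec set" where
  "add_box_minus n S v =
     {append_bit (0\<^sub>v n) 0, append_bit v 0} \<union>
     {append_bit u 1 | u. u \<in> S - {0\<^sub>v n, v}}"

end

theory Submission
  imports Defs
begin

text \<open>
  The zero vector lies in every powerful set, because $2^k \neq 0$ forces some member to vanish
  on all of $\{1,\dots,n\}$. Hence deleting the last bit maps $S + \Box \setminus v$ bijectively
  onto $S$, and the counts for sets $X$ avoiding the new position are those of $S$. If $X$
  contains the new position, only $\mathbf{0}0$ and possibly $v0$ survive, so the count is 1 or 2.
\<close>

lemma append_bit_carrier: "u \<in> carrier_vec n \<Longrightarrow> append_bit u a \<in> carrier_vec (n + 1)"
  unfolding append_bit_def carrier_vec_def by simp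

lemma index_append_bit_less: "u \<in> carrier_vec n \<Longrightarrow> i < n \<Longrightarrow> append_bit u a $ i = u $ i"
  unfolding append_bit_def carrier_vec_def by simp

lemma index_append_bit_last: "u \<in> carrier_vec n \<Longrightarrow> append_bit u a $ n = a"
  unfolding append_bit_def carrier_vec_def by simp

text \<open>The first \<open>n\<close> entries alone determine the vector. The bits \<open>a\<close>
  and \<open>b\<close> may differ because the map \<open>p\<close> in the main proof lets the
  appended bit depend on the vector.\<close>

lemma append_bit_inject:
  assumes "u \<in> carrier_vec n" "w \<in> carrier_vec n" "append_bit u a = append_bit w b"
  shows "u = w"
  using assms append_vec_eq[OF assms(1,2)] unfolding append_bit_def by blast

lemma zero_in_powerful_set:
  assumes "powerful_set n S"
  shows "0\<^sub>v n \<in> S"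
proof -
  obtain k :: nat where "card {u \<in> S. \<forall>i\<in>{..<n}. u $ i = 0} = 2 ^ k"
    using assms unfolding powerful_set_def by blast
  then have "{u \<in> S. \<forall>i\<in>{..<n}. u $ i = 0} \<noteq> {}"
    by (metis card.empty power_eq_0_iff zero_neq_numeral)
  then obtain u where u: "u \<in> S" "\<forall>i<n. u $ i = 0" by auto
  moreover have "u \<in> carrier_vec n" using u assms unfolding powerful_set_def by blast
  ultimately have "u = 0\<^sub>v n" by (intro eq_vecI) auto
  with u show ?thesis by simp
qed

theorem theorem5:
  fixes n :: nat and S :: "bit vec set" and v :: "bit vec"
  assumes "powerful_set n S"
    and "v \<in> S"
    and "v \<noteq> 0\<^sub>v n"
  shows "powerful_set (n + 1) (add_box_minus n S v)"
proof -
  have S: "S \<subseteq> carrier_vec n" using assms(1) unfolding powerful_set_def by blast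
  have zero: "0\<^sub>v n \<in> S" using zero_in_powerful_set[OF assms(1)] .
  \<comment> \<open>\<open>p\<close> is the inverse of deleting the last bit, written as a single
    function so that counts can be moved from the new set to \<open>S\<close>.\<close>
  define p where "p u = append_bit u (if u = 0\<^sub>v n \<or> u = v then 0 else 1)" for u
  \<comment> \<open>Both exceptional vectors lie in \<open>S\<close>, so \<open>p\<close> also
    reaches the two members that end in 0.\<close>
  have image: "add_box_minus n S v = p ` S"
    unfolding add_box_minus_def p_def using zero assms(2) by auto
  have inj: "inj_on p S"
    unfolding p_def using S append_bit_inject by (intro inj_onI) blast
  have less: "p u $ i = u $ i" if "u \<in> S" "i < n" for u i
    unfolding p_def using that S index_append_bit_less by blast
  \<comment> \<open>Indices start at 0, so \<open>n\<close> is the position of the appended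
    bit.\<close>
  have last: "p u $ n = 0 \<longleftrightarrow> u = 0\<^sub>v n \<or> u = v" if "u \<in> S" for u
    unfolding p_def using that S index_append_bit_last[of u n] by auto
  have "\<exists>k. card {w \<in> p ` S. \<forall>i\<in>X. w $ i = 0} = 2 ^ k" if X: "X \<subseteq> {..<n + 1}" for X
  proof -
    \<comment> \<open>Pulling the condition back along the injective \<open>p\<close> turns the
      count into one over \<open>S\<close>.\<close>
    have "{w \<in> p ` S. \<forall>i\<in>X. w $ i = 0} = p ` {u \<in> S. \<forall>i\<in>X. p u $ i = 0}" by blast
    then have card_eq: "card {w \<in> p ` S. \<forall>i\<in>X. w $ i = 0} = card {u \<in> S. \<forall>i\<in>X. p u $ i = 0}"
      using card_image[OF inj_on_subset[OF inj]] by (metis (no_types, lifting) mem_Collect_eq subsetI)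
    show ?thesis
    proof (cases "n \<in> X")
      case False
      then have Xn: "X \<subseteq> {..<n}" using X by (auto simp: less_Suc_eq)
      then have "p u $ i = u $ i" if "u \<in> S" "i \<in> X" for u i
        using less that by blast
      then have "{u \<in> S. \<forall>i\<in>X. p u $ i = 0} = {u \<in> S. \<forall>i\<in>X. u $ i = 0}"
        by (intro Collect_cong conj_cong ball_cong) simp_all
      then show ?thesis using card_eq assms(1) Xn unfolding powerful_set_def by simp
    next
      case True
      let ?A = "{u \<in> S. \<forall>i\<in>X. p u $ i = 0}"
      have sub: "?A \<subseteq> {0\<^sub>v n, v}" using True last by auto
      have "p (0\<^sub>v n) $ i = 0" if "i \<in> X" for i
      proof (cases "i = n")
        case True
        then show ?thesis using last[OF zero] by simp
      next
        case False
        then have "i < n" using that X by auto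
        then show ?thesis using less[OF zero] by simp
      qed
      then have "0\<^sub>v n \<in> ?A" using zero by blast
      \<comment> \<open>Since the zero vector always survives, the count is never 0. Whether
        \<open>v\<close> survives depends on the rest of \<open>X\<close>; if it does, being nonzero
        it makes the count exactly 2.\<close>
      with sub have "?A = {0\<^sub>v n} \<or> ?A = {0\<^sub>v n, v}" by blast
      then have "card ?A = 2 ^ 0 \<or> card ?A = 2 ^ 1" using assms(3) by auto
      then show ?thesis using card_eq by metis
    qed
  qed
  moreover have "p ` S \<subseteq> carrier_vec (n + 1)"
    unfolding p_def using S append_bit_carrier by blast
  ultimately show ?thesis unfolding powerful_set_def image by blast
qed

end
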